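(* Let $A$ be a monomial algebra over an infinite field $K$. If $A$ is not exhaustively amenable as a right module over itself, then $A$ contains a noncommutative free subalgebra generated by homogeneous elements (that is, there is a set of at least two homogeneous elements of $A$ which freely generate a free $K$-subalgebra of $A$).
   Context: Algebras are associative and unital. A monomial algebra over $K$ is an algebra $A\cong K\langle x_1,\dots,x_d\rangle/I$ where $I$ is an ideal generated by (non-empty) monomials $x_{i_1}\cdots x_{i_r}$. It is graded by length of monomials: $A=\bigoplus_{i\geq0}A_i$, with $A_i$ spanned by the length-$i$ monomials; homogeneous refers to this grading. For a right $A$-module $M$, a finite-dimensional subspace $V\leq A$ and $\varepsilon>0$, a finite-dimensional subspace $L\leq M$ is $(V,\varepsilon)$-invariant if $\dim_K LV<(1+\varepsilon)\dim_K L$, where $LV$ is the span of all products $\ell v$. The module $M$ is exhaustively amenable if for every finite-dimensional $V\leq A$, every $\varepsilon>0$ and every finite-dimensional $W\leq M$ there is a $(V,\varepsilon)$-invariant subspace of $M$ containing $W$. *)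

theory Defs
  imports Complex_Main "HOL-Library.Poly_Mapping"
begin

section \<open>Associative unital algebras and their right modules\<close>

text \<open>The class \<^class>\<open>ring_1\<close> excludes the zero ring. This is no restriction for
  monomial algebras: an ideal generated by non-empty words is proper.\<close>

locale K_algebra = vector_space scale
  for scale :: "'k::field \<Rightarrow> 'a::ring_1 \<Rightarrow> 'a" +
  assumes scale_mult_left: "scale c (x * y) = scale c x * y"
    and scale_mult_right: "scale c (x * y) = x * scale c y"

definition (in vector_space) fin_dim_subspace :: "'b set \<Rightarrow> bool" where
  "fin_dim_subspace V \<longleftrightarrow> (\<exists>B. finite B \<and> V = span B)"

locale right_module = K_algebra scale + M: vector_space scaleM
  for scale :: "'k::field \<Rightarrow> 'a::ring_1 \<Rightarrow> 'a"
    and scaleM :: "'k \<Rightarrow> 'm::ab_group_add \<Rightarrow> 'm"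
    and act :: "'m \<Rightarrow> 'a \<Rightarrow> 'm" +
  assumes act_one: "act m 1 = m"
    and act_mult: "act m (a * b) = act (act m a) b"
    and act_add_left: "act (m + n) a = act m a + act n a"
    and act_add_right: "act m (a + b) = act m a + act m b"
    and act_scale_left: "act (scaleM c m) a = scaleM c (act m a)"
    and act_scale_right: "act m (scale c a) = scaleM c (act m a)"
begin

definition product_space :: "'m set \<Rightarrow> 'a set \<Rightarrow> 'm set" where
  "product_space L V = M.span {act l v | l v. l \<in> L \<and> v \<in> V}"

definition invariant_subspace :: "'a set \<Rightarrow> real \<Rightarrow> 'm set \<Rightarrow> bool" where
  "invariant_subspace V \<epsilon> L \<longleftrightarrow>
     M.fin_dim_subspace L \<and>
     real (M.dim (product_space L V)) < (1 + \<epsilon>) * real (M.dim L)"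

definition exhaustively_amenable :: bool where
  "exhaustively_amenable \<longleftrightarrow>
     (\<forall>V \<epsilon> W. fin_dim_subspace V \<longrightarrow> \<epsilon> > 0 \<longrightarrow> M.fin_dim_subspace W \<longrightarrow>
        (\<exists>L. invariant_subspace V \<epsilon> L \<and> W \<subseteq> L))"

end

lemma (in K_algebra) right_module_self: "right_module scale scale (*)"
  by unfold_locales
    (simp_all add: mult.assoc distrib_left distrib_right scale_mult_left [symmetric]
      scale_mult_right [symmetric])

section \<open>Free algebras and monomial algebras\<close>

text \<open>With lists as the free monoid (written additively), \<^typ>\<open>'x list \<Rightarrow>\<^sub>0 'k\<close> is the monoid
  algebra of words, its convolution product being induced by concatenation.\<close>

instantiation list :: (type) monoid_add
begin

definition zero_list_def: "0 = []"
definition plus_list_def: "xs + ys = xs @ ys" for xs ys :: "'a list"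

instance
  by standard (simp_all add: zero_list_def plus_list_def)

end

definition free_algebra :: "'x set \<Rightarrow> ('x list \<Rightarrow>\<^sub>0 'k::field) set" where
  "free_algebra X = {p. Poly_Mapping.keys p \<subseteq> lists X}"

definition word_monomial :: "'x list \<Rightarrow> ('x list \<Rightarrow>\<^sub>0 'k::field)" where
  "word_monomial w = Poly_Mapping.single w 1"

definition two_sided_ideal :: "'x set \<Rightarrow> ('x list \<Rightarrow>\<^sub>0 'k::field) set \<Rightarrow> bool" where
  "two_sided_ideal X I \<longleftrightarrow> I \<subseteq> free_algebra X \<and> 0 \<in> I \<and>
     (\<forall>p\<in>I. \<forall>q\<in>I. p + q \<in> I) \<and>
     (\<forall>p\<in>I. \<forall>a\<in>free_algebra X. a * p \<in> I \<and> p * a \<in> I)"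

definition monomial_ideal :: "'x set \<Rightarrow> 'x list set \<Rightarrow> ('x list \<Rightarrow>\<^sub>0 'k::field) set" where
  "monomial_ideal X R = two_sided_ideal X hull (word_monomial ` R)"

definition residue_class ::
    "'x set \<Rightarrow> 'x list set \<Rightarrow> ('x list \<Rightarrow>\<^sub>0 'k::field) \<Rightarrow> ('x list \<Rightarrow>\<^sub>0 'k) set" where
  "residue_class X R p = {p + i | i. i \<in> monomial_ideal X R}"

text \<open>\<open>\<phi>\<close> is an isomorphism from the quotient of the free algebra on the letters
  \<open>0, \<dots>, d - 1\<close> by the ideal generated by the words in \<open>R\<close> (which may be infinite) onto the
  algebra. The operations of the quotient are given by representatives;
  \<^term>\<open>Poly_Mapping.single [] c * p\<close> is the scalar multiple of \<open>p\<close> by \<open>c\<close>, because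
  \<open>[]\<close> is the unit of the monoid of words.\<close>

locale monomial_algebra = K_algebra scale
  for scale :: "'k::field \<Rightarrow> 'a::ring_1 \<Rightarrow> 'a" +
  fixes d :: nat
    and R :: "nat list set"
    and \<phi> :: "(nat list \<Rightarrow>\<^sub>0 'k) set \<Rightarrow> 'a"
  assumes relations_words: "R \<subseteq> lists {..<d}"
    and relations_nonempty: "[] \<notin> R"
    and iso_bij: "bij_betw \<phi> (residue_class {..<d} R ` free_algebra {..<d}) UNIV"
    and iso_one: "\<phi> (residue_class {..<d} R 1) = 1"
    and iso_add: "\<lbrakk>p \<in> free_algebra {..<d}; q \<in> free_algebra {..<d}\<rbrakk> \<Longrightarrow>
      \<phi> (residue_class {..<d} R (p + q)) =
        \<phi> (residue_class {..<d} R p) + \<phi> (residue_class {..<d} R q)"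
    and iso_mult: "\<lbrakk>p \<in> free_algebra {..<d}; q \<in> free_algebra {..<d}\<rbrakk> \<Longrightarrow>
      \<phi> (residue_class {..<d} R (p * q)) =
        \<phi> (residue_class {..<d} R p) * \<phi> (residue_class {..<d} R q)"
    and iso_scale: "p \<in> free_algebra {..<d} \<Longrightarrow>
      \<phi> (residue_class {..<d} R (Poly_Mapping.single [] c * p)) =
        scale c (\<phi> (residue_class {..<d} R p))"
begin

definition graded_piece :: "nat \<Rightarrow> 'a set" where
  "graded_piece n =
     span {\<phi> (residue_class {..<d} R (word_monomial w)) | w. w \<in> lists {..<d} \<and> length w = n}"

definition homogeneous :: "'a \<Rightarrow> bool" where
  "homogeneous a \<longleftrightarrow> (\<exists>n. a \<in> graded_piece n)"

end

section \<open>Free subalgebras\<close>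

context K_algebra
begin

text \<open>The homomorphism from the free algebra on a subset \<open>S\<close> of the algebra which extends the
  inclusion of \<open>S\<close>: the letters are themselves elements of the algebra.\<close>

definition evaluation :: "('a list \<Rightarrow>\<^sub>0 'k) \<Rightarrow> 'a" where
  "evaluation p = (\<Sum>w\<in>Poly_Mapping.keys p. scale (Poly_Mapping.lookup p w) (prod_list w))"

definition freely_generates_subalgebra :: "'a set \<Rightarrow> bool" where
  "freely_generates_subalgebra S \<longleftrightarrow> inj_on evaluation (free_algebra S)"

end

end

theory Submission
  imports Defs
begin

text \<open>Monomials identify a monomial algebra with the span of the language of its nonzero words,
  and right multiplication by a letter moves from a word to one of its children in the prefix
  tree of this language. Testing amenability on subspaces spanned by words turns its failure into
  an isoperimetric inequality: finite sets of nonzero words that contain a fixed ball expand by a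
  factor \<open>1 + \<epsilon>\<close> when words of length at most \<open>n\<close> are appended.

  Long thin pieces of the tree do not expand. Finite subtrees cannot be left at all, so only
  finitely many words have finitely many continuations; and a long path without side branches
  gains at most \<open>n\<close> new words at its end. Hence there are a nonzero word \<open>u\<close> and a length \<open>N\<close>
  such that every nonzero word starting with \<open>u\<close> has two distinct nonzero continuations of length
  \<open>N\<close> (lemma \<open>branching\<close>).

  Let \<open>x\<close> range over the words of length \<open>N\<close>, choose pairwise distinct scalars \<open>\<beta> x\<close>, which is
  possible over an infinite field, and put \<open>a = \<Sum> x\<close> and \<open>b = \<Sum> \<beta> x \<cdot> x\<close>. A noncommutative
  polynomial \<open>f = c + a P + b Q\<close> then evaluates to \<open>c + \<Sum> x (P + \<beta> x Q)\<close>. If \<open>u v f = 0\<close>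
  for a nonzero word \<open>u v\<close>, the summands vanish separately, because they involve disjoint sets of
  words; in particular \<open>c = 0\<close>. Two nonzero continuations \<open>x\<close>, \<open>x'\<close> of \<open>u v\<close> give by induction on
  the degree \<open>P + \<beta> x Q = 0\<close> and \<open>P + \<beta> x' Q = 0\<close> as formal polynomials, whence \<open>P = Q = 0\<close>.
  So \<open>a\<close> and \<open>b\<close> generate a free algebra, which even acts freely on the right of \<open>u\<close>
  (lemma \<open>branching_imp_free\<close>).\<close>

section \<open>Expanding prefix-closed languages branch everywhere below some word\<close>

locale prefix_closed_language =
  fixes X :: "'x set" and Lang :: "'x list set"
  assumes finite_alphabet: "finite X"
    and Lang_words: "Lang \<subseteq> lists X"
    and Nil_in_Lang: "[] \<in> Lang"
    and prefix_in_Lang: "u @ v \<in> Lang \<Longrightarrow> u \<in> Lang"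
begin

definition extensions :: "nat \<Rightarrow> 'x list set \<Rightarrow> 'x list set" where
  "extensions n T = {t @ w | t w. t \<in> T \<and> length w \<le> n \<and> t @ w \<in> Lang}"

definition dead :: "'x list \<Rightarrow> bool" where
  "dead v \<longleftrightarrow> v \<in> Lang \<and> (\<exists>k. \<forall>w. length w = k \<longrightarrow> v @ w \<notin> Lang)"

lemma finite_words_le: "finite {w \<in> Lang. length w \<le> n}"
  by (rule finite_subset[OF _ finite_lists_length_le[OF finite_alphabet, of n]])
    (use Lang_words in auto)

lemma finite_extensions:
  assumes "finite T"
  shows "finite (extensions n T)"
proof -
  have "extensions n T \<subseteq> (\<Union>t\<in>T. (@) t ` {w. set w \<subseteq> X \<and> length w \<le> n})"
    using Lang_words unfolding extensions_def by fastforce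
  then show ?thesis
    using assms finite_lists_length_le[OF finite_alphabet, of n] finite_subset by fast
qed

text \<open>A word without continuation of length \<open>k\<close> has no longer one either, since the language is
  closed under prefixes.\<close>

lemma finite_continuations_of_dead:
  assumes "dead v"
  shows "finite {v @ w | w. v @ w \<in> Lang}"
proof -
  from assms obtain k where k: "\<And>w. length w = k \<Longrightarrow> v @ w \<notin> Lang"
    unfolding dead_def by blast
  have "length w \<le> k" if "v @ w \<in> Lang" for w
  proof (rule ccontr)
    assume "\<not> length w \<le> k"
    then have "length (take k w) = k" by simp
    moreover have "v @ take k w \<in> Lang"
      using prefix_in_Lang[of "v @ take k w" "drop k w"] that by simp
    ultimately show False using k by blast
  qed
  then have "{v @ w | w. v @ w \<in> Lang} \<subseteq> {w \<in> Lang. length w \<le> length v + k}"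
    by auto
  then show ?thesis using finite_words_le finite_subset by blast
qed

end

text \<open>The combinatorial form of non-amenability: \<open>n\<close> is the length up to which words are
  appended and \<open>m\<close> the radius of the ball that the test sets have to contain.\<close>

locale expanding_language = prefix_closed_language +
  fixes n m :: nat and \<epsilon> :: real
  assumes eps_pos: "\<epsilon> > 0"
    and expanding: "\<lbrakk>finite T; T \<subseteq> Lang; {w \<in> Lang. length w \<le> m} \<subseteq> T\<rbrakk> \<Longrightarrow>
      (1 + \<epsilon>) * real (card T) \<le> real (card (extensions n T))"
begin

definition defect :: real where
  "defect = real (card {w \<in> Lang. length w \<le> m + n})"

text \<open>Adjoining the ball of radius \<open>m\<close> to an arbitrary finite set adds at most \<open>defect\<close> words to its
  extensions. At this bounded cost, the inequality applies to sets far away from the root.\<close>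

lemma expanding_up_to_defect:
  assumes "finite T" "T \<subseteq> Lang"
  shows "(1 + \<epsilon>) * real (card T) \<le> defect + real (card (extensions n T))"
proof -
  define B where "B = {w \<in> Lang. length w \<le> m}"
  have fin: "finite (B \<union> T)" using assms finite_words_le by (simp add: B_def)
  have "(1 + \<epsilon>) * real (card T) \<le> (1 + \<epsilon>) * real (card (B \<union> T))"
    using eps_pos fin by (intro mult_left_mono) (auto intro: card_mono)
  also have "\<dots> \<le> real (card (extensions n (B \<union> T)))"
    using expanding[OF fin] assms by (auto simp: B_def)
  also have "extensions n (B \<union> T) \<subseteq> {w \<in> Lang. length w \<le> m + n} \<union> extensions n T"
    unfolding extensions_def B_def by auto
  then have "card (extensions n (B \<union> T)) \<le>
      card ({w \<in> Lang. length w \<le> m + n} \<union> extensions n T)"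
    using finite_words_le finite_extensions[OF assms(1)] by (intro card_mono) auto
  also have "\<dots> \<le> card {w \<in> Lang. length w \<le> m + n} + card (extensions n T)"
    by (rule card_Un_le)
  finally show ?thesis by (simp add: defect_def)
qed

lemma infinite_Lang: "infinite Lang"
proof
  assume fin: "finite Lang"
  have "extensions n Lang \<subseteq> Lang" unfolding extensions_def by auto
  then have "card (extensions n Lang) \<le> card Lang" by (rule card_mono[OF fin])
  moreover have "(1 + \<epsilon>) * real (card Lang) \<le> real (card (extensions n Lang))"
    using expanding[OF fin] by auto
  ultimately have "\<epsilon> * real (card Lang) \<le> 0" by (simp add: algebra_simps)
  moreover have "card Lang > 0" using fin Nil_in_Lang by (auto simp: card_gt_0_iff)
  ultimately show False using eps_pos by (simp add: mult_le_0_iff)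
qed

text \<open>The union of the finite subtrees below dead words is closed under extensions, so its size is at
  most \<open>defect / \<epsilon>\<close>; it contains these dead words.\<close>

lemma finite_dead: "finite {v. dead v}"
proof -
  have "card F \<le> nat \<lceil>defect / \<epsilon>\<rceil>" if F: "F \<subseteq> {v. dead v}" "finite F" for F
  proof -
    define T where "T = (\<Union>v\<in>F. {v @ w | w. v @ w \<in> Lang})"
    have fin: "finite T"
      unfolding T_def using F finite_continuations_of_dead by blast
    have "T \<subseteq> Lang" unfolding T_def by auto
    have "extensions n T \<subseteq> T" unfolding extensions_def T_def by force
    then have "real (card (extensions n T)) \<le> real (card T)"
      using fin by (simp add: card_mono)
    with expanding_up_to_defect[OF fin \<open>T \<subseteq> Lang\<close>]
    have "real (card T) \<le> defect / \<epsilon>"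
      using eps_pos by (simp add: field_simps)
    moreover have "F \<subseteq> T"
      using F unfolding T_def dead_def by force
    then have "card F \<le> card T" using fin by (simp add: card_mono)
    ultimately show ?thesis by linarith
  qed
  then show ?thesis using finite_if_finite_subsets_card_bdd by blast
qed

text \<open>Below a word \<open>u\<close> longer than all dead words, every path can be continued. If all continuations
  of some \<open>u @ v\<close> agreed up to length \<open>N\<close>, they would form a path whose first \<open>l + 1\<close> nodes are
  too many for an expanding set.\<close>

lemma branching:
  obtains u N where "u \<in> Lang"
    and "\<And>v. u @ v \<in> Lang \<Longrightarrow> \<exists>w w'. w \<noteq> w' \<and> length w = N \<and> length w' = N \<and>
      u @ v @ w \<in> Lang \<and> u @ v @ w' \<in> Lang"
proof -
  obtain M where M: "\<And>v. dead v \<Longrightarrow> length v < M"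
    using finite_nat_set_iff_bounded[of "length ` {v. dead v}"] finite_dead by auto
  obtain u where u: "u \<in> Lang" "length u \<ge> M"
  proof (rule ccontr)
    assume "\<not> thesis"
    then have "Lang \<subseteq> {w \<in> Lang. length w \<le> M}" using that by force
    then show False using finite_words_le infinite_Lang finite_subset by blast
  qed
  have alive: "\<exists>w. length w = k \<and> u @ v @ w \<in> Lang" if "u @ v \<in> Lang" for v k
  proof -
    have "\<not> dead (u @ v)" using M[of "u @ v"] u(2) by auto
    then show ?thesis using that unfolding dead_def by auto
  qed
  \<comment> \<open>Large enough to violate \<open>\<epsilon> * (l + 1) \<le> defect + n\<close>.\<close>
  define l where "l = nat \<lceil>(defect + real n) / \<epsilon>\<rceil>"
  define N where "N = l + n"
  have "\<exists>w w'. w \<noteq> w' \<and> length w = N \<and> length w' = N \<and>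
      u @ v @ w \<in> Lang \<and> u @ v @ w' \<in> Lang" if v: "u @ v \<in> Lang" for v
  proof (rule ccontr)
    assume no: "\<not> ?thesis"
    obtain w where w: "length w = N" "u @ v @ w \<in> Lang" using alive[OF v] by blast
    have unique: "w' = w" if "length w' = N" "u @ v @ w' \<in> Lang" for w'
      using no w that by blast
    define node where "node k = u @ v @ take k w" for k
    have inj: "inj_on node {..N}"
      by (rule inj_onI) (simp add: node_def, metis length_take min.absorb2 w(1))
    have node_Lang: "node k \<in> Lang" for k
      using prefix_in_Lang[of "u @ v @ take k w" "drop k w"] w by (simp add: node_def)
    have ext: "extensions n (node ` {..l}) \<subseteq> node ` {..N}"
    proof
      fix y assume "y \<in> extensions n (node ` {..l})"
      then obtain k x where k: "k \<le> l" "length x \<le> n" "y = node k @ x" "y \<in> Lang"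
        unfolding extensions_def by blast
      then have "u @ (v @ take k w @ x) \<in> Lang" by (simp add: node_def)
      \<comment> \<open>Prolonging \<open>y\<close> to the full length \<open>N\<close> forces it onto the path.\<close>
      from alive[OF this, of "N - (k + length x)"]
      obtain x' where x': "length x' = N - (k + length x)"
        "u @ v @ (take k w @ x @ x') \<in> Lang" by auto
      have kN: "k + length x \<le> N" using k by (simp add: N_def)
      have "take k w @ x @ x' = w" 
        using x' kN w(1) by (intro unique) auto
      then have "take (k + length x) w = take (k + length x) (take k w @ x @ x')" by simp
      also have "\<dots> = take k w @ x" using kN w(1) by simp
      finally have "y = node (k + length x)" using k by (simp add: node_def)
      then show "y \<in> node ` {..N}" using kN by auto
    qed
    have "card (extensions n (node ` {..l})) \<le> card (node ` {..N})"
      using ext by (intro card_mono) auto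
    also have "\<dots> = N + 1" by (simp add: card_image[OF inj])
    finally have 1: "real (card (extensions n (node ` {..l}))) \<le> real l + real n + 1"
      by (simp add: N_def)
    have "card (node ` {..l}) = l + 1"
      using card_image[OF inj_on_subset[OF inj]] by (auto simp: N_def)
    then have "(1 + \<epsilon>) * (real l + 1) \<le> defect + (real l + real n + 1)"
      using expanding_up_to_defect[of "node ` {..l}"] node_Lang 1 by (force simp: add.commute)
    then have "\<epsilon> * (real l + 1) \<le> defect + real n" by (simp add: algebra_simps)
    then have "real l + 1 \<le> (defect + real n) / \<epsilon>"
      using eps_pos by (simp add: field_simps)
    moreover have "(defect + real n) / \<epsilon> \<le> real l" unfolding l_def by linarith
    ultimately show False by linarith
  qed
  with u that show thesis by blast
qed

end

section \<open>Algebras with a multiplicative basis of words\<close>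

text \<open>The distinct nonzero values of \<open>mon\<close> form a basis, and no two words share such a value. The
  vanishing of \<open>mon\<close> on some words encodes the monomial relations.\<close>

locale word_basis_algebra = K_algebra scale
  for scale :: "'k::field \<Rightarrow> 'a::ring_1 \<Rightarrow> 'a" +
  fixes X :: "'x set" and mon :: "'x list \<Rightarrow> 'a"
  assumes finite_letters: "finite X"
    and mon_Nil: "mon [] = 1"
    and mon_append: "\<lbrakk>u \<in> lists X; v \<in> lists X\<rbrakk> \<Longrightarrow> mon (u @ v) = mon u * mon v"
    and mon_indep: "\<lbrakk>finite F; F \<subseteq> lists X; (\<Sum>w\<in>F. scale (c w) (mon w)) = 0; w \<in> F; mon w \<noteq> 0\<rbrakk>
      \<Longrightarrow> c w = 0"
    and mon_span: "span (mon ` lists X) = UNIV"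
begin

definition nonzero_words :: "'x list set" where
  "nonzero_words = {w \<in> lists X. mon w \<noteq> 0}"

sublocale prefix_closed_language X nonzero_words
proof
  show "u \<in> nonzero_words" if "u @ v \<in> nonzero_words" for u v
    using that mon_append[of u v] by (auto simp: nonzero_words_def)
qed (auto simp: finite_letters nonzero_words_def mon_Nil)

lemma linear_combination_of_words:
  obtains F e where "finite F" "F \<subseteq> lists X" "z = (\<Sum>w\<in>F. scale (e w) (mon w))"
proof -
  have "z \<in> span (mon ` lists X)" using mon_span by simp
  then obtain t r where t: "finite t" "t \<subseteq> mon ` lists X" "z = (\<Sum>a\<in>t. scale (r a) a)"
    unfolding span_explicit by blast
  from t(2) obtain F where F: "F \<subseteq> lists X" "inj_on mon F" "t = mon ` F"
    unfolding subset_image_inj by blast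
  show thesis
  proof
    show "finite F" using t F finite_image_iff by blast
    show "z = (\<Sum>w\<in>F. scale (r (mon w)) (mon w))"
      using t F by (simp add: sum.reindex)
  qed fact
qed

lemma inj_on_mon_nonzero: "inj_on mon nonzero_words"
proof (rule inj_onI, rule ccontr)
  fix x y assume *: "x \<in> nonzero_words" "y \<in> nonzero_words" "mon x = mon y" "x \<noteq> y"
  define c :: "'x list \<Rightarrow> 'k" where "c w = (if w = x then 1 else - 1)" for w
  have "(\<Sum>w\<in>{x, y}. scale (c w) (mon w)) = 0"
    using * by (simp add: c_def)
  then have "c x = 0"
    using * by (intro mon_indep[of "{x, y}"]) (auto simp: nonzero_words_def)
  then show False by (simp add: c_def)
qed

lemma independent_mon:
  assumes "finite T" "T \<subseteq> nonzero_words"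
  shows "independent (mon ` T)"
proof (rule independent_if_scalars_zero)
  show "finite (mon ` T)" using assms by simp
  fix f x assume *: "(\<Sum>x\<in>mon ` T. scale (f x) x) = 0" "x \<in> mon ` T"
  then obtain w where w: "w \<in> T" "x = mon w" by blast
  have "(\<Sum>w\<in>T. scale (f (mon w)) (mon w)) = 0"
    using * inj_on_subset[OF inj_on_mon_nonzero assms(2)] by (simp add: sum.reindex)
  then show "f x = 0"
    using mon_indep[of T "\<lambda>w. f (mon w)" w] w assms by (auto simp: nonzero_words_def)
qed

lemma dim_span_mon:
  assumes "finite T" "T \<subseteq> nonzero_words"
  shows "dim (span (mon ` T)) = card T"
  using independent_mon[OF assms] card_image[OF inj_on_subset[OF inj_on_mon_nonzero assms(2)]]
  by (simp add: dim_eq_card_independent)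

lemma fin_dim_bounded_words:
  assumes "fin_dim_subspace V"
  obtains n where "V \<subseteq> span (mon ` {w \<in> lists X. length w \<le> n})"
proof -
  from assms obtain B where B: "finite B" "V = span B" unfolding fin_dim_subspace_def by blast
  have "\<exists>n. b \<in> span (mon ` {w \<in> lists X. length w \<le> n})" for b
  proof -
    obtain F e where F: "finite F" "F \<subseteq> lists X" "b = (\<Sum>w\<in>F. scale (e w) (mon w))"
      by (rule linear_combination_of_words)
    obtain n where "\<And>w. w \<in> F \<Longrightarrow> length w \<le> n"
      using F(1) finite_nat_set_iff_bounded_le[of "length ` F"] by auto
    then have "b \<in> span (mon ` {w \<in> lists X. length w \<le> n})"
      unfolding F(3) using F(2) by (intro span_sum span_scale span_base) auto
    then show ?thesis ..
  qed
  then obtain f where f: "\<And>b. b \<in> span (mon ` {w \<in> lists X. length w \<le> f b})" by metis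
  obtain n where n: "\<And>b. b \<in> B \<Longrightarrow> f b \<le> n"
    using B(1) finite_nat_set_iff_bounded_le[of "f ` B"] by auto
  have "b \<in> span (mon ` {w \<in> lists X. length w \<le> n})" if "b \<in> B" for b
    using f[of b] n[OF that]
      span_mono[of "mon ` {w \<in> lists X. length w \<le> f b}" "mon ` {w \<in> lists X. length w \<le> n}"]
    by fastforce
  then have "B \<subseteq> span (mon ` {w \<in> lists X. length w \<le> n})" by blast
  then have "V \<subseteq> span (mon ` {w \<in> lists X. length w \<le> n})"
    using B(2) span_minimal subspace_span by blast
  then show thesis by (rule that)
qed

lemma mult_in_span_extensions:
  assumes "T \<subseteq> nonzero_words" "l \<in> span (mon ` T)"
    and "v \<in> span (mon ` {w \<in> lists X. length w \<le> n})"
  shows "l * v \<in> span (mon ` extensions n T)"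
  using assms(2)
proof (induction rule: span_induct_alt)
  case base
  then show ?case by (simp add: span_zero)
next
  case (step c x y)
  then obtain t where t: "t \<in> T" "x = mon t" by blast
  have "x * v \<in> span (mon ` extensions n T)"
    using assms(3)
  proof (induction rule: span_induct_alt)
    case base
    then show ?case by (simp add: span_zero)
  next
    case (step c' x' y')
    then obtain w where w: "w \<in> lists X" "length w \<le> n" "x' = mon w" by blast
    have tX: "t \<in> lists X" using t assms(1) by (auto simp: nonzero_words_def)
    have "mon (t @ w) \<in> span (mon ` extensions n T)"
    proof (cases "mon (t @ w) = 0")
      case False
      then have "t @ w \<in> extensions n T"
        using t w tX unfolding extensions_def by (auto simp: nonzero_words_def)
      then show ?thesis by (intro span_base) auto
    qed (simp add: span_zero)
    then have "x * x' \<in> span (mon ` extensions n T)"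
      using mon_append[OF tX w(1)] t w by simp
    then show ?case
      using step by (simp add: distrib_left scale_mult_right[symmetric] span_add span_scale)
  qed
  then show ?case
    using step by (simp add: distrib_right scale_mult_left[symmetric] span_add span_scale)
qed

text \<open>A span of nonzero words has the number of these words as its dimension, and multiplying it by
  \<open>V\<close> stays within the span of their extensions. So a set violating the inequality would span an
  invariant subspace.\<close>

lemma not_amenable_imp_expanding:
  assumes "\<not> right_module.exhaustively_amenable scale scale (*)"
  obtains n m \<epsilon> where "expanding_language X nonzero_words n m \<epsilon>"
proof -
  interpret RM: right_module scale scale "(*)" by (rule right_module_self)
  from assms obtain V W \<epsilon> where V: "fin_dim_subspace V" and W: "fin_dim_subspace W"
    and eps: "\<epsilon> > 0" and none: "\<And>L. W \<subseteq> L \<Longrightarrow> \<not> RM.invariant_subspace V \<epsilon> L"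
    unfolding RM.exhaustively_amenable_def by blast
  obtain n where n: "V \<subseteq> span (mon ` {w \<in> lists X. length w \<le> n})"
    using fin_dim_bounded_words[OF V] .
  obtain m where m: "W \<subseteq> span (mon ` {w \<in> lists X. length w \<le> m})"
    using fin_dim_bounded_words[OF W] .
  have "expanding_language X nonzero_words n m \<epsilon>"
  proof
    fix T assume T: "finite T" "T \<subseteq> nonzero_words"
      and mT: "{w \<in> nonzero_words. length w \<le> m} \<subseteq> T"
    have "mon w \<in> span (mon ` T)" if "w \<in> lists X" "length w \<le> m" for w
      using that mT span_zero span_base[of "mon w"]
      by (cases "mon w = 0") (auto simp: nonzero_words_def)
    then have "mon ` {w \<in> lists X. length w \<le> m} \<subseteq> span (mon ` T)" by blast
    then have "W \<subseteq> span (mon ` T)"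
      using m span_minimal subspace_span by (meson order_trans)
    then have "\<not> RM.invariant_subspace V \<epsilon> (span (mon ` T))" by (rule none)
    moreover have "fin_dim_subspace (span (mon ` T))"
      unfolding fin_dim_subspace_def using T by blast
    ultimately have 1: "(1 + \<epsilon>) * real (dim (span (mon ` T))) \<le>
        real (dim (RM.product_space (span (mon ` T)) V))"
      unfolding RM.invariant_subspace_def by simp
    have "RM.product_space (span (mon ` T)) V \<subseteq> span (mon ` extensions n T)"
      unfolding RM.product_space_def
      using mult_in_span_extensions[OF T(2)] n by (intro span_minimal subspace_span) blast
    then have "dim (RM.product_space (span (mon ` T)) V) \<le> card (mon ` extensions n T)"
      using finite_extensions[OF T(1)] by (intro dim_le_card) auto
    also have "\<dots> \<le> card (extensions n T)"
      using finite_extensions[OF T(1)] by (rule card_image_le)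
    finally show "(1 + \<epsilon>) * real (card T) \<le> real (card (extensions n T))"
      using 1 dim_span_mon[OF T] by simp
  qed (fact eps)
  then show thesis by (rule that)
qed

text \<open>Left multiplication by distinct words of equal length gives linear combinations of disjoint
  sets of words, and none of these words is the common prefix \<open>y\<close>. There is no cancellation
  between the summands.\<close>

lemma prefix_separation:
  assumes y: "y \<in> lists X" and Y: "finite Y" "Y \<subseteq> lists X"
    and len: "\<And>x. x \<in> Y \<Longrightarrow> length x = N" and "N > 0"
    and zero: "scale c (mon y) + (\<Sum>x\<in>Y. mon (y @ x) * z x) = 0"
  shows "mon y \<noteq> 0 \<Longrightarrow> c = 0" and "x \<in> Y \<Longrightarrow> mon (y @ x) * z x = 0"
proof -
  have "\<forall>x. \<exists>F e. finite F \<and> F \<subseteq> lists X \<and> z x = (\<Sum>w\<in>F. scale (e w) (mon w))"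
    using linear_combination_of_words by metis
  then obtain F e where F: "\<And>x. finite (F x)" "\<And>x. F x \<subseteq> lists X"
    and z: "\<And>x. z x = (\<Sum>w\<in>F x. scale (e x w) (mon w))" by metis
  define word where "word = (\<lambda>(x, w). y @ x @ w)"
  define G where "G = word ` Sigma Y F"
  \<comment> \<open>The lengths of \<open>y\<close> and \<open>x\<close> are known, so the triple can be read off the concatenated word.\<close>
  define coef where "coef v = (if v = y then c else
    e (take N (drop (length y) v)) (drop (length y + N) v))" for v
  have coef: "coef (y @ x @ w) = e x w" if "x \<in> Y" for x w
    using len[OF that] \<open>N > 0\<close> by (auto simp: coef_def)
  have inj: "inj_on word (Sigma Y F)"
    by (rule inj_onI) (auto simp: word_def len)
  have finG: "finite (insert y G)" unfolding G_def using Y F by auto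
  have GX: "insert y G \<subseteq> lists X"
    using y Y F by (force simp: G_def word_def)
  have notin: "y \<notin> G" using len \<open>N > 0\<close> by (force simp: G_def word_def)
  have term_eq: "mon (y @ x) * z x = (\<Sum>w\<in>F x. scale (e x w) (mon (y @ x @ w)))" if "x \<in> Y" for x
  proof -
    have "mon (y @ x) * mon w = mon (y @ x @ w)" if "w \<in> F x" for w
      using that mon_append[of "y @ x" w] y Y F \<open>x \<in> Y\<close> by (auto simp: subset_iff)
    then show ?thesis
      unfolding z sum_distrib_left by (simp add: scale_mult_right[symmetric])
  qed
  have "(\<Sum>v\<in>G. scale (coef v) (mon v)) =
      (\<Sum>(x, w)\<in>Sigma Y F. scale (e x w) (mon (y @ x @ w)))"
    unfolding G_def sum.reindex[OF inj]
    by (rule sum.cong) (auto simp: word_def coef)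
  also have "\<dots> = (\<Sum>x\<in>Y. mon (y @ x) * z x)"
    using Y F by (simp add: sum.Sigma[symmetric] term_eq)
  finally have total: "(\<Sum>v\<in>insert y G. scale (coef v) (mon v)) = 0"
    using zero notin finG by (simp add: coef_def)
  note vanish = mon_indep[OF finG GX total]
  show "c = 0" if "mon y \<noteq> 0"
    using vanish[of y] that by (simp add: coef_def)
  show "mon (y @ x) * z x = 0" if x: "x \<in> Y"
  proof -
    have "scale (e x w) (mon (y @ x @ w)) = 0" if "w \<in> F x" for w
    proof (cases "mon (y @ x @ w) = 0")
      case False
      have "y @ x @ w \<in> insert y G" using x that by (force simp: G_def word_def)
      from vanish[OF this False] show ?thesis using coef[OF x] by simp
    qed simp
    then show ?thesis unfolding term_eq[OF x] by (intro sum.neutral) blast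
  qed
qed

end

section \<open>Branching yields a free subalgebra\<close>

lemma sum_words_Suc:
  fixes f :: "'s list \<Rightarrow> 'b::comm_monoid_add"
  assumes "finite S"
  shows "(\<Sum>w\<in>{w \<in> lists S. length w \<le> Suc k}. f w) =
    f [] + (\<Sum>s\<in>S. \<Sum>w\<in>{w \<in> lists S. length w \<le> k}. f (s # w))"
proof -
  let ?W = "\<lambda>k. {w \<in> lists S. length w \<le> k}"
  have fin: "finite (?W k)" for k
    by (rule finite_subset[OF _ finite_lists_length_le[OF assms, of k]]) auto
  have split: "?W (Suc k) = insert [] ((\<lambda>(s, w). s # w) ` (S \<times> ?W k))"
  proof (intro equalityI subsetI)
    fix w assume "w \<in> ?W (Suc k)"
    then show "w \<in> insert [] ((\<lambda>(s, w). s # w) ` (S \<times> ?W k))" by (cases w) force+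
  qed auto
  have inj: "inj_on (\<lambda>(s, w). s # w) (S \<times> ?W k)" by (auto simp: inj_on_def)
  have "(\<Sum>w\<in>?W (Suc k). f w) = f [] + (\<Sum>w\<in>(\<lambda>(s, w). s # w) ` (S \<times> ?W k). f w)"
    unfolding split using fin[of k] assms by (intro sum.insert) auto
  also have "(\<Sum>w\<in>(\<lambda>(s, w). s # w) ` (S \<times> ?W k). f w) = (\<Sum>(s, w)\<in>S \<times> ?W k. f (s # w))"
    unfolding sum.reindex[OF inj] by (simp add: case_prod_beta)
  finally show ?thesis by (simp add: sum.cartesian_product)
qed

context K_algebra
begin

lemma evaluation_superset:
  assumes "finite F" "Poly_Mapping.keys p \<subseteq> F"
  shows "evaluation p = (\<Sum>w\<in>F. scale (Poly_Mapping.lookup p w) (prod_list w))"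
  unfolding evaluation_def using assms
  by (intro sum.mono_neutral_left) (auto simp: in_keys_iff)

lemma freely_generatesI:
  assumes "finite S"
    and zero: "\<And>k c. (\<Sum>w\<in>{w \<in> lists S. length w \<le> k}. scale (c w) (prod_list w)) = 0 \<Longrightarrow>
      \<forall>w\<in>{w \<in> lists S. length w \<le> k}. c w = 0"
  shows "freely_generates_subalgebra S"
  unfolding freely_generates_subalgebra_def
proof (rule inj_onI)
  fix p q :: "'a list \<Rightarrow>\<^sub>0 'k"
  assume pq: "p \<in> free_algebra S" "q \<in> free_algebra S" "evaluation p = evaluation q"
  obtain k where k: "\<And>w. w \<in> Poly_Mapping.keys p \<union> Poly_Mapping.keys q \<Longrightarrow> length w \<le> k"
    using finite_nat_set_iff_bounded_le[of "length ` (Poly_Mapping.keys p \<union> Poly_Mapping.keys q)"]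
    by auto
  define F where "F = {w \<in> lists S. length w \<le> k}"
  have F: "finite F" unfolding F_def
    by (rule finite_subset[OF _ finite_lists_length_le[OF assms(1), of k]]) auto
  have sub: "Poly_Mapping.keys p \<subseteq> F" "Poly_Mapping.keys q \<subseteq> F"
    using pq k unfolding F_def free_algebra_def by auto
  have "(\<Sum>w\<in>F. scale (Poly_Mapping.lookup p w - Poly_Mapping.lookup q w) (prod_list w)) = 0"
    using pq(3) evaluation_superset[OF F sub(1)] evaluation_superset[OF F sub(2)]
    by (simp add: scale_left_diff_distrib sum_subtractf)
  then have "\<forall>w\<in>F. Poly_Mapping.lookup p w - Poly_Mapping.lookup q w = 0"
    unfolding F_def by (rule zero)
  moreover have "Poly_Mapping.lookup p w = 0 \<and> Poly_Mapping.lookup q w = 0" if "w \<notin> F" for w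
    using that sub by (meson in_keys_iff subsetD)
  ultimately have "Poly_Mapping.lookup p w = Poly_Mapping.lookup q w" for w
    by (cases "w \<in> F") auto
  then show "p = q" by (rule poly_mapping_eqI)
qed

end

context word_basis_algebra
begin

text \<open>Two values \<open>\<beta> x \<noteq> \<beta> x'\<close> suffice to recover \<open>P\<close> and \<open>Q\<close> from \<open>P + \<beta> x Q\<close> and
  \<open>P + \<beta> x' Q\<close>; which two words \<open>x\<close> and \<open>x'\<close> are available depends on the position in the
  tree, so \<open>\<beta>\<close> has to be injective on all words of length \<open>N\<close>.\<close>

lemma branching_imp_free:
  assumes inf: "infinite (UNIV :: 'k set)"
    and u: "u \<in> nonzero_words"
    and branch: "\<And>v. u @ v \<in> nonzero_words \<Longrightarrow> \<exists>w w'. w \<noteq> w' \<and> length w = N \<and> length w' = N \<and>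
      u @ v @ w \<in> nonzero_words \<and> u @ v @ w' \<in> nonzero_words"
  obtains a b where "a \<noteq> b"
    and "{a, b} \<subseteq> span (mon ` {w \<in> lists X. length w = N})"
    and "freely_generates_subalgebra {a, b}"
proof -
  define Y where "Y = {w \<in> lists X. length w = N}"
  have Y: "finite Y" "Y \<subseteq> lists X" and len: "\<And>x. x \<in> Y \<Longrightarrow> length x = N"
    using finite_lists_length_eq[OF finite_alphabet, of N] finite_subset
    by (auto simp: Y_def lists_eq_set)
  obtain \<beta> :: "'x list \<Rightarrow> 'k" where \<beta>: "inj_on \<beta> Y"
    using Y(1) inf by (metis card_le_inj finite_subset infinite_arbitrarily_large order_refl subset_UNIV)
  define a where "a = (\<Sum>x\<in>Y. mon x)"
  define b where "b = (\<Sum>x\<in>Y. scale (\<beta> x) (mon x))"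
  have branch': "\<exists>x\<in>Y. \<exists>x'\<in>Y. x \<noteq> x' \<and> u @ v @ x \<in> nonzero_words \<and> u @ v @ x' \<in> nonzero_words"
    if "u @ v \<in> nonzero_words" for v
    using branch[OF that] by (fastforce simp: Y_def nonzero_words_def)
  obtain x1 x2 where x12: "x1 \<in> Y" "x2 \<in> Y" "x1 \<noteq> x2"
    "u @ x1 \<in> nonzero_words" "u @ x2 \<in> nonzero_words"
    using branch'[of "[]"] u by auto
  have "N > 0" using x12 len[of x1] len[of x2] by (cases N) auto
  have "a \<noteq> b"
  proof
    assume "a = b"
    then have "(\<Sum>x\<in>Y. scale (1 - \<beta> x) (mon x)) = 0"
      by (simp add: scale_left_diff_distrib sum_subtractf a_def b_def)
    moreover have "mon x1 \<noteq> 0" "mon x2 \<noteq> 0"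
      using x12 u Y mon_append[of u x1] mon_append[of u x2] by (auto simp: nonzero_words_def)
    ultimately have "1 - \<beta> x1 = 0" "1 - \<beta> x2 = 0"
      using mon_indep[OF Y, of "\<lambda>x. 1 - \<beta> x"] x12 by blast+
    then show False using inj_onD[OF \<beta> _ x12(1,2)] x12(3) by simp
  qed
  \<comment> \<open>Stated for all positions \<open>u @ v\<close> because the induction on the degree descends in the tree.\<close>
  have vanish: "\<forall>w\<in>{w \<in> lists {a, b}. length w \<le> k}. c w = 0"
    if "u @ v \<in> nonzero_words"
      and "mon (u @ v) * (\<Sum>w\<in>{w \<in> lists {a, b}. length w \<le> k}. scale (c w) (prod_list w)) = 0"
    for k v c
    using that
  proof (induction k arbitrary: v c)
    case 0
    have "{w \<in> lists {a, b}. length w \<le> 0} = {[]}" by auto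
    with 0 show ?case by (simp add: scale_mult_right[symmetric] nonzero_words_def)
  next
    case (Suc k)
    let ?W = "{w \<in> lists {a, b}. length w \<le> k}"
    let ?P = "\<lambda>s. \<Sum>w\<in>?W. scale (c (s # w)) (prod_list w)"
    let ?z = "\<lambda>x. \<Sum>w\<in>?W. scale (c (a # w) + \<beta> x * c (b # w)) (prod_list w)"
    have uvX: "u @ v \<in> lists X" using Suc.prems by (simp add: nonzero_words_def)
    have z: "?z x = ?P a + scale (\<beta> x) (?P b)" for x
      by (simp add: scale_left_distrib sum.distrib scale_sum_right)
    have "(\<Sum>w\<in>{w \<in> lists {a, b}. length w \<le> Suc k}. scale (c w) (prod_list w)) =
        scale (c []) 1 + (a * ?P a + b * ?P b)"
      using \<open>a \<noteq> b\<close> by (simp add: sum_words_Suc sum_distrib_left scale_mult_right)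
    also have "a * ?P a + b * ?P b = (\<Sum>x\<in>Y. mon x * ?z x)"
      unfolding z unfolding a_def b_def sum_distrib_right
      by (simp add: distrib_left sum.distrib scale_mult_left[symmetric] scale_mult_right[symmetric])
    finally have "mon (u @ v) * (scale (c []) 1 + (\<Sum>x\<in>Y. mon x * ?z x)) = 0"
      using Suc.prems(2) by simp
    moreover have "mon (u @ v) * (mon x * ?z x) = mon ((u @ v) @ x) * ?z x" if "x \<in> Y" for x
      using that Y mon_append[OF uvX, of x] by (simp add: mult.assoc subset_iff)
    ultimately have zero: "scale (c []) (mon (u @ v)) + (\<Sum>x\<in>Y. mon ((u @ v) @ x) * ?z x) = 0"
      by (simp add: distrib_left scale_mult_right[symmetric] sum_distrib_left)
    note sep = prefix_separation[OF uvX Y len \<open>N > 0\<close> zero]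
    have c0: "c [] = 0" using sep(1) Suc.prems by (simp add: nonzero_words_def)
    have step: "c (a # w) + \<beta> x * c (b # w) = 0"
      if "w \<in> ?W" "x \<in> Y" "u @ v @ x \<in> nonzero_words" for w x
      using Suc.IH[of "v @ x" "\<lambda>w. c (a # w) + \<beta> x * c (b # w)"] sep(2)[of x] that by simp
    obtain x x' where x: "x \<in> Y" "x' \<in> Y" "x \<noteq> x'"
      "u @ v @ x \<in> nonzero_words" "u @ v @ x' \<in> nonzero_words"
      using branch'[OF Suc.prems(1)] by blast
    have cs: "c (a # w) = 0 \<and> c (b # w) = 0" if "w \<in> ?W" for w
    proof -
      have eqs: "c (a # w) + \<beta> x * c (b # w) = 0" "c (a # w) + \<beta> x' * c (b # w) = 0"
        using step[OF that] x by blast+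
      have "(\<beta> x - \<beta> x') * c (b # w) =
          (c (a # w) + \<beta> x * c (b # w)) - (c (a # w) + \<beta> x' * c (b # w))"
        by (simp add: left_diff_distrib)
      also have "\<dots> = 0" by (simp only: eqs diff_self)
      finally have "(\<beta> x - \<beta> x') * c (b # w) = 0" .
      moreover have "\<beta> x \<noteq> \<beta> x'" using \<beta> x by (auto dest: inj_onD)
      ultimately show ?thesis using eqs by simp
    qed
    show ?case
    proof
      fix w assume "w \<in> {w \<in> lists {a, b}. length w \<le> Suc k}"
      then show "c w = 0" using c0 cs by (cases w) auto
    qed
  qed
  have "freely_generates_subalgebra {a, b}"
  proof (rule freely_generatesI)
    fix k and c :: "'a list \<Rightarrow> 'k"
    assume "(\<Sum>w\<in>{w \<in> lists {a, b}. length w \<le> k}. scale (c w) (prod_list w)) = 0"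
    then show "\<forall>w\<in>{w \<in> lists {a, b}. length w \<le> k}. c w = 0"
      using vanish[of "[]" c k] u by simp
  qed simp
  moreover have "{a, b} \<subseteq> span (mon ` Y)"
    unfolding a_def b_def by (auto intro: span_sum span_scale span_base)
  ultimately show thesis using that \<open>a \<noteq> b\<close> unfolding Y_def by blast
qed

end

section \<open>Monomial algebras have a multiplicative basis of words\<close>

lemma free_algebra_add: "\<lbrakk>p \<in> free_algebra X; q \<in> free_algebra X\<rbrakk> \<Longrightarrow> p + q \<in> free_algebra X"
  using keys_add[of p q] by (auto simp: free_algebra_def)

lemma free_algebra_mult: "\<lbrakk>p \<in> free_algebra X; q \<in> free_algebra X\<rbrakk> \<Longrightarrow> p * q \<in> free_algebra X"
  using keys_mult[of p q] by (fastforce simp: free_algebra_def plus_list_def)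

lemma single_in_free_algebra: "w \<in> lists X \<Longrightarrow> Poly_Mapping.single w c \<in> free_algebra X"
  by (simp add: free_algebra_def)

lemma word_monomial_append: "word_monomial (u @ v) = word_monomial u * word_monomial v"
  by (simp add: word_monomial_def mult_single plus_list_def)

text \<open>Having a factor in \<open>R\<close> survives prepending and appending words. This ideal bounds the
  generated one from above, which is what makes the remaining words linearly independent.\<close>

lemma two_sided_ideal_words_with_factor:
  assumes "R \<subseteq> lists X"
  shows "two_sided_ideal X {p :: 'x list \<Rightarrow>\<^sub>0 'k::field. p \<in> free_algebra X \<and>
    (\<forall>w\<in>Poly_Mapping.keys p. \<exists>s r t. r \<in> R \<and> w = s @ r @ t)}" (is "two_sided_ideal X ?J")
  unfolding two_sided_ideal_def
proof (intro conjI ballI)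
  show "?J \<subseteq> free_algebra X" by blast
  show "0 \<in> ?J" by (simp add: free_algebra_def)
  show "p + q \<in> ?J" if "p \<in> ?J" "q \<in> ?J" for p q
    using that keys_add[of p q] by (auto intro: free_algebra_add)
  fix p a :: "'x list \<Rightarrow>\<^sub>0 'k" assume p: "p \<in> ?J" and a: "a \<in> free_algebra X"
  have "\<exists>s r t. r \<in> R \<and> w = s @ r @ t" if w: "w \<in> Poly_Mapping.keys (a * p)" for w
  proof -
    obtain x y where "y \<in> Poly_Mapping.keys p" "w = x @ y"
      using subsetD[OF keys_mult w] unfolding plus_list_def by blast
    moreover from this obtain s r t where "r \<in> R" "y = s @ r @ t" using p by blast
    ultimately have "r \<in> R" "w = (x @ s) @ r @ t" by simp_all
    then show ?thesis by blast
  qed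
  then show "a * p \<in> ?J" using p a by (auto intro: free_algebra_mult)
  have "\<exists>s r t. r \<in> R \<and> w = s @ r @ t" if w: "w \<in> Poly_Mapping.keys (p * a)" for w
  proof -
    obtain x y where "y \<in> Poly_Mapping.keys p" "w = y @ x"
      using subsetD[OF keys_mult w] unfolding plus_list_def by blast
    moreover from this obtain s r t where "r \<in> R" "y = s @ r @ t" using p by blast
    ultimately have "r \<in> R" "w = s @ r @ (t @ x)" by simp_all
    then show ?thesis by blast
  qed
  then show "p * a \<in> ?J" using p a by (auto intro: free_algebra_mult)
qed

lemma monomial_ideal_keys:
  assumes "R \<subseteq> lists X" "p \<in> monomial_ideal X R" "w \<in> Poly_Mapping.keys p"
  shows "\<exists>s r t. r \<in> R \<and> w = s @ r @ t"
proof -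
  let ?J = "{p. p \<in> free_algebra X \<and> (\<forall>w\<in>Poly_Mapping.keys p. \<exists>s r t. r \<in> R \<and> w = s @ r @ t)}"
  have "word_monomial r \<in> ?J" if "r \<in> R" for r
    using that assms(1) by (auto simp: word_monomial_def free_algebra_def)
      (metis append_Nil append_Nil2)
  then have "monomial_ideal X R \<subseteq> ?J"
    unfolding monomial_ideal_def
    by (intro hull_minimal two_sided_ideal_words_with_factor[OF assms(1)]) auto
  then show ?thesis using assms by blast
qed

lemma two_sided_ideal_monomial_ideal:
  assumes "R \<subseteq> lists X"
  shows "two_sided_ideal X (monomial_ideal X R :: ('x list \<Rightarrow>\<^sub>0 'k::field) set)"
proof -
  have "two_sided_ideal X (free_algebra X :: ('x list \<Rightarrow>\<^sub>0 'k) set)"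
    unfolding two_sided_ideal_def
    by (auto intro: free_algebra_add free_algebra_mult) (simp add: free_algebra_def)
  moreover have "word_monomial ` R \<subseteq> (free_algebra X :: ('x list \<Rightarrow>\<^sub>0 'k) set)"
    using assms by (auto simp: word_monomial_def free_algebra_def)
  ultimately have "monomial_ideal X R \<subseteq> (free_algebra X :: ('x list \<Rightarrow>\<^sub>0 'k) set)"
    unfolding monomial_ideal_def by (intro hull_minimal)
  then show ?thesis
    unfolding two_sided_ideal_def monomial_ideal_def hull_def by blast
qed

lemma residue_class_eq_iff:
  fixes p q :: "'x list \<Rightarrow>\<^sub>0 'k::field"
  assumes "R \<subseteq> lists X"
  shows "residue_class X R p = residue_class X R q \<longleftrightarrow> p - q \<in> monomial_ideal X R"
proof -
  note I = two_sided_ideal_monomial_ideal[OF assms, unfolded two_sided_ideal_def]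
  have add: "i + j \<in> monomial_ideal X R"
    if "i \<in> monomial_ideal X R" "j \<in> monomial_ideal X R" for i j :: "'x list \<Rightarrow>\<^sub>0 'k"
    using I that by blast
  have neg: "- i \<in> monomial_ideal X R" if "i \<in> monomial_ideal X R" for i :: "'x list \<Rightarrow>\<^sub>0 'k"
  proof -
    have "- 1 \<in> (free_algebra X :: ('x list \<Rightarrow>\<^sub>0 'k) set)"
      by (simp add: free_algebra_def zero_list_def)
    then have "- 1 * i \<in> monomial_ideal X R" using I that by blast
    then show ?thesis by simp
  qed
  show ?thesis
  proof
    assume "residue_class X R p = residue_class X R q"
    moreover have "p \<in> residue_class X R p"
      unfolding residue_class_def using I by force
    ultimately show "p - q \<in> monomial_ideal X R"
      unfolding residue_class_def by auto
  next
    assume d: "p - q \<in> monomial_ideal X R"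
    have "p + i \<in> residue_class X R q" if "i \<in> monomial_ideal X R" for i
      unfolding residue_class_def using add[OF d that]
      by (intro CollectI exI[of _ "(p - q) + i"]) simp
    moreover have "q + i \<in> residue_class X R p" if "i \<in> monomial_ideal X R" for i
    proof -
      have "- (p - q) + i \<in> monomial_ideal X R" using add[OF neg[OF d] that] .
      then show ?thesis unfolding residue_class_def
        by (intro CollectI exI[of _ "- (p - q) + i"]) simp
    qed
    ultimately show "residue_class X R p = residue_class X R q"
      unfolding residue_class_def by blast
  qed
qed

context monomial_algebra
begin

abbreviation image_of :: "(nat list \<Rightarrow>\<^sub>0 'k) \<Rightarrow> 'a" where
  "image_of p \<equiv> \<phi> (residue_class {..<d} R p)"

abbreviation word_image :: "nat list \<Rightarrow> 'a" where
  "word_image w \<equiv> image_of (word_monomial w)"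

lemma image_of_zero: "image_of 0 = 0"
  using iso_add[of 0 0] by (simp add: free_algebra_def)

lemma image_of_sum:
  assumes "finite F" "F \<subseteq> lists {..<d}"
  shows "image_of (\<Sum>w\<in>F. Poly_Mapping.single w (c w)) = (\<Sum>w\<in>F. scale (c w) (word_image w))"
    and "(\<Sum>w\<in>F. Poly_Mapping.single w (c w)) \<in> free_algebra {..<d}"
proof -
  have "image_of (\<Sum>w\<in>F. Poly_Mapping.single w (c w)) = (\<Sum>w\<in>F. scale (c w) (word_image w)) \<and>
    (\<Sum>w\<in>F. Poly_Mapping.single w (c w)) \<in> free_algebra {..<d}"
    using assms
  proof (induction F rule: finite_induct)
    case empty
    show ?case by (simp add: image_of_zero) (simp add: free_algebra_def)
  next
    case (insert w F)
    have "Poly_Mapping.single w (c w) = Poly_Mapping.single [] (c w) * word_monomial w"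
      by (simp add: word_monomial_def mult_single plus_list_def)
    moreover have "word_monomial w \<in> (free_algebra {..<d} :: (nat list \<Rightarrow>\<^sub>0 'k) set)"
      using insert by (simp add: word_monomial_def single_in_free_algebra)
    ultimately have "image_of (Poly_Mapping.single w (c w)) = scale (c w) (word_image w)"
      by (simp add: iso_scale)
    then show ?case
      using insert by (simp add: iso_add free_algebra_add single_in_free_algebra)
  qed
  then show "image_of (\<Sum>w\<in>F. Poly_Mapping.single w (c w)) = (\<Sum>w\<in>F. scale (c w) (word_image w))"
    and "(\<Sum>w\<in>F. Poly_Mapping.single w (c w)) \<in> free_algebra {..<d}" by blast+
qed

lemma word_image_append:
  "\<lbrakk>u \<in> lists {..<d}; v \<in> lists {..<d}\<rbrakk> \<Longrightarrow> word_image (u @ v) = word_image u * word_image v"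
  by (simp add: word_monomial_append iso_mult)
    (simp add: iso_mult word_monomial_def single_in_free_algebra)

lemma word_image_relation:
  assumes "r \<in> R"
  shows "word_image r = 0"
proof -
  have "word_monomial r \<in> monomial_ideal {..<d} R"
    unfolding monomial_ideal_def using assms by (intro hull_inc) auto
  then have "residue_class {..<d} R (word_monomial r :: nat list \<Rightarrow>\<^sub>0 'k) = residue_class {..<d} R 0"
    by (simp add: residue_class_eq_iff[OF relations_words])
  then show ?thesis by (simp add: image_of_zero)
qed

text \<open>A vanishing combination of images lies in the ideal, so each word in its support has a factor
  in \<open>R\<close>; but then the image of this word is zero.\<close>

lemma word_image_independent:
  assumes F: "finite F" "F \<subseteq> lists {..<d}" and zero: "(\<Sum>w\<in>F. scale (c w) (word_image w)) = 0"
    and w: "w \<in> F" "word_image w \<noteq> 0"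
  shows "c w = 0"
proof (rule ccontr)
  assume "c w \<noteq> 0"
  let ?p = "\<Sum>w\<in>F. Poly_Mapping.single w (c w)"
  have "image_of ?p = image_of 0"
    using image_of_sum(1)[OF F] zero image_of_zero by simp
  moreover have "0 \<in> (free_algebra {..<d} :: (nat list \<Rightarrow>\<^sub>0 'k) set)"
    by (simp add: free_algebra_def)
  ultimately have "residue_class {..<d} R ?p = residue_class {..<d} R 0"
    using image_of_sum(2)[OF F] bij_betw_imp_inj_on[OF iso_bij] by (auto dest: inj_onD)
  then have p: "?p \<in> monomial_ideal {..<d} R"
    by (simp add: residue_class_eq_iff[OF relations_words])
  have "Poly_Mapping.lookup ?p w = c w"
    using F w by (simp add: lookup_sum lookup_single when_def)
  then have "w \<in> Poly_Mapping.keys ?p"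
    using \<open>c w \<noteq> 0\<close> by (simp add: in_keys_iff)
  from monomial_ideal_keys[OF relations_words p this]
  obtain s r t where r: "r \<in> R" "w = s @ r @ t" by blast
  have "w \<in> lists {..<d}" using F w by blast
  then have "s \<in> lists {..<d}" "r \<in> lists {..<d}" "t \<in> lists {..<d}" using r by auto
  then have "word_image w = word_image s * (word_image r * word_image t)"
    using r word_image_append by simp
  then show False using w word_image_relation[OF r(1)] by simp
qed

lemma word_image_span: "span (word_image ` lists {..<d}) = UNIV"
proof -
  have "a \<in> span (word_image ` lists {..<d})" for a
  proof -
    obtain p where p: "p \<in> free_algebra {..<d}" "a = image_of p"
      using bij_betw_imp_surj_on[OF iso_bij] by (metis (no_types, lifting) UNIV_I imageE)
    have sub: "Poly_Mapping.keys p \<subseteq> lists {..<d}" using p by (simp add: free_algebra_def)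
    have "p = (\<Sum>w\<in>Poly_Mapping.keys p. Poly_Mapping.single w (Poly_Mapping.lookup p w))"
      by (rule poly_mapping_eqI) (auto simp: lookup_sum lookup_single when_def in_keys_iff)
    then have "a = (\<Sum>w\<in>Poly_Mapping.keys p. scale (Poly_Mapping.lookup p w) (word_image w))"
      using p image_of_sum(1)[OF finite_keys sub] by metis
    then show ?thesis using sub
      by (simp only:) (intro span_sum span_scale span_base, blast)
  qed
  then show ?thesis by blast
qed

sublocale words: word_basis_algebra scale "{..<d}" word_image
proof
  show "word_image [] = 1"
    using iso_one by (simp add: word_monomial_def flip: single_one) (simp add: zero_list_def)
qed (use word_image_append word_image_independent word_image_span in auto)

end

theorem theorem1p3:
  fixes scale :: "'k::field \<Rightarrow> 'a::ring_1 \<Rightarrow> 'a"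
    and d :: nat
    and R :: "nat list set"
    and \<phi> :: "(nat list \<Rightarrow>\<^sub>0 'k) set \<Rightarrow> 'a"
  assumes "infinite (UNIV :: 'k set)"
    and "monomial_algebra scale d R \<phi>"
    and "\<not> right_module.exhaustively_amenable scale scale (*)"
  shows "\<exists>S. (\<exists>s\<in>S. \<exists>t\<in>S. s \<noteq> t) \<and>
             (\<forall>s\<in>S. monomial_algebra.homogeneous scale d R \<phi> s) \<and>
             K_algebra.freely_generates_subalgebra scale S"
proof -
  interpret monomial_algebra scale d R \<phi> by fact
  obtain n m \<epsilon> where "expanding_language {..<d} words.nonzero_words n m \<epsilon>"
    using words.not_amenable_imp_expanding[OF assms(3)] .
  then interpret expanding_language "{..<d}" words.nonzero_words n m \<epsilon> .
  obtain u N where u: "u \<in> words.nonzero_words"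
    and branch: "\<And>v. u @ v \<in> words.nonzero_words \<Longrightarrow>
      \<exists>w w'. w \<noteq> w' \<and> length w = N \<and> length w' = N \<and>
        u @ v @ w \<in> words.nonzero_words \<and> u @ v @ w' \<in> words.nonzero_words"
    using branching by blast
  obtain a b where ab: "a \<noteq> b" "{a, b} \<subseteq> span (word_image ` {w \<in> lists {..<d}. length w = N})"
    "freely_generates_subalgebra {a, b}"
    using words.branching_imp_free[OF assms(1) u branch] by blast
  have "word_image ` {w \<in> lists {..<d}. length w = N} =
      {word_image w | w. w \<in> lists {..<d} \<and> length w = N}" by blast
  then have "homogeneous a" "homogeneous b"
    using ab(2) unfolding homogeneous_def graded_piece_def by auto
  with ab show ?thesis by (intro exI[of _ "{a, b}"]) auto
qed

end
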